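(* For $r, \sigma, \delta, m\in \mathbb N$ with $r \geq 2$ and $\log^{(2\delta)}m\geq 1$, we have $\chi(W_r(m,\sigma,\delta)) \leq 2^{2^{2+r^{\sigma + \delta - 2}(r+1)}} \cdot \log^{(2\delta)}m$.
   Context: $\log^{(j)}$ denotes the base-2 logarithm iterated $j$ times ($\log^{(0)}m=m$). The graph $W_r(m,\sigma,\delta)$ has vertex set all tuples $\langle\alpha,A_1,\dots,A_\delta\rangle$ with $\alpha\in A_1\subset A_2\subset\cdots\subset A_\delta\subseteq[m]$ and $|A_i|=r^{i-1}\cdot r^{\sigma}$ for $1\le i\le\delta$; two vertices $\langle\alpha,A_1,\dots,A_\delta\rangle$, $\langle\beta,B_1,\dots,B_\delta\rangle$ are adjacent iff $\alpha\neq\beta$, $\alpha\in B_1$, $\beta\in A_1$, and $A_i\subseteq B_{i+1}$, $B_i\subseteq A_{i+1}$ for all $1\le i\le\delta-1$. *)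

theory Defs
  imports Complex_Main
begin

(* Undefined iterates (logarithm of a non-positive number) are set to 0, which again has
   iterate 0.  Hence iter_log j x >= 1 forces every earlier iterate to be positive.  The guard
   is needed because the library logarithm satisfies ln (- x) = ln x. *)
fun iter_log :: "nat \<Rightarrow> real \<Rightarrow> real" where
  "iter_log 0 x = x"
| "iter_log (Suc j) x = (if iter_log j x > 0 then log 2 (iter_log j x) else 0)"

lemma iter_log_ge_1_imp_pos:
  assumes "iter_log j x \<ge> 1" "i \<le> j"
  shows "iter_log i x > 0"
proof -
  have "iter_log (i + d) x \<ge> 1 \<Longrightarrow> iter_log i x > 0" for d
  proof (rule ccontr)
    assume ge: "iter_log (i + d) x \<ge> 1" and np: "\<not> iter_log i x > 0"
    from np have "iter_log (i + d) x \<le> 0"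
      by (induction d) auto
    with ge show False by simp
  qed
  from this[of "j - i"] assms show ?thesis by simp
qed

definition proper_colouring ::
  "'a set \<Rightarrow> ('a \<Rightarrow> 'a \<Rightarrow> bool) \<Rightarrow> nat \<Rightarrow> ('a \<Rightarrow> nat) \<Rightarrow> bool" where
  "proper_colouring V adj k c \<longleftrightarrow>
     (\<forall>v\<in>V. c v < k) \<and> (\<forall>u\<in>V. \<forall>v\<in>V. adj u v \<longrightarrow> c u \<noteq> c v)"

definition chromatic_number :: "'a set \<Rightarrow> ('a \<Rightarrow> 'a \<Rightarrow> bool) \<Rightarrow> nat" where
  "chromatic_number V adj = (LEAST k. \<exists>c. proper_colouring V adj k c)"

lemma chromatic_number_attained:
  assumes "finite V" "\<And>v. \<not> adj v v"
  shows "\<exists>c. proper_colouring V adj (chromatic_number V adj) c"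
proof -
  obtain c :: "'a \<Rightarrow> nat" and n where "c ` V = {i. i < n}" "inj_on c V"
    using finite_imp_inj_to_nat_seg[OF assms(1)] by blast
  then have "proper_colouring V adj n c"
    using assms(2) unfolding proper_colouring_def inj_on_def by blast
  then show ?thesis
    unfolding chromatic_number_def by (intro LeastI) blast
qed

(* The vertex <alpha, A_1, ..., A_delta> is the pair (alpha, [A_1, ..., A_delta]); list indices
   start at 0, so A_i is A ! (i - 1).  Meaningful for delta >= 1 only. *)
type_synonym W_vertex = "nat \<times> nat set list"

definition W_vertices :: "nat \<Rightarrow> nat \<Rightarrow> nat \<Rightarrow> nat \<Rightarrow> W_vertex set" where
  "W_vertices r m \<sigma> \<delta> =
     {(\<alpha>, A). length A = \<delta> \<and> \<alpha> \<in> A ! 0 \<and>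
        (\<forall>i. Suc i < \<delta> \<longrightarrow> A ! i \<subset> A ! Suc i) \<and>
        A ! (\<delta> - 1) \<subseteq> {1..m} \<and>
        (\<forall>i<\<delta>. card (A ! i) = r ^ i * r ^ \<sigma>)}"

definition W_adj :: "nat \<Rightarrow> W_vertex \<Rightarrow> W_vertex \<Rightarrow> bool" where
  "W_adj \<delta> = (\<lambda>(\<alpha>, A) (\<beta>, B).
     \<alpha> \<noteq> \<beta> \<and> \<alpha> \<in> B ! 0 \<and> \<beta> \<in> A ! 0 \<and>
     (\<forall>i. Suc i < \<delta> \<longrightarrow> A ! i \<subseteq> B ! Suc i \<and> B ! i \<subseteq> A ! Suc i))"

lemma W_adj_irrefl: "\<not> W_adj \<delta> v v"
  by (auto simp: W_adj_def)

lemma W_adj_sym: "W_adj \<delta> u v \<Longrightarrow> W_adj \<delta> v u"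
  by (auto simp: W_adj_def)

lemma finite_W_vertices:
  assumes "\<delta> \<ge> 1"
  shows "finite (W_vertices r m \<sigma> \<delta>)"
proof (rule finite_subset)
  show "finite ({1..m} \<times> {A. set A \<subseteq> Pow {1..m} \<and> length A = \<delta>})"
    by (intro finite_cartesian_product finite_lists_length_eq) auto
  show "W_vertices r m \<sigma> \<delta> \<subseteq> {1..m} \<times> {A. set A \<subseteq> Pow {1..m} \<and> length A = \<delta>}"
  proof
    fix v assume v: "v \<in> W_vertices r m \<sigma> \<delta>"
    obtain \<alpha> A where [simp]: "v = (\<alpha>, A)" by (cases v)
    from v have len: "length A = \<delta>" and mem: "\<alpha> \<in> A ! 0"
      and chain: "\<And>i. Suc i < \<delta> \<Longrightarrow> A ! i \<subset> A ! Suc i"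
      and top: "A ! (\<delta> - 1) \<subseteq> {1..m}"
      by (auto simp: W_vertices_def)
    have sub: "A ! i \<subseteq> {1..m}" if "i \<le> \<delta> - 1" for i
      using that
    proof (induction rule: inc_induct)
      case base
      show ?case by (fact top)
    next
      case (step n)
      then have "Suc n < \<delta>" by linarith
      with chain step.IH show ?case by blast
    qed
    have "set A \<subseteq> Pow {1..m}"
    proof
      fix S assume "S \<in> set A"
      then obtain i where "i < \<delta>" "S = A ! i" using len by (auto simp: in_set_conv_nth)
      with sub[of i] show "S \<in> Pow {1..m}" by simp
    qed
    moreover have "\<alpha> \<in> {1..m}" using sub[of 0] mem by blast
    ultimately show "v \<in> {1..m} \<times> {A. set A \<subseteq> Pow {1..m} \<and> length A = \<delta>}"
      using len by simp
  qed
qed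

end

theory Submission
  imports Defs
begin

text \<open>
  Suppose a proper colouring with \<open>M\<close> colours is such that every vertex knows a set of at most \<open>P\<close>
  colours containing those of its neighbours. A family of subsets of the bit positions
  \<open>{..<log M}\<close> that induces every pattern on every set of at most \<open>P\<close> positions exists with
  about \<open>2 ^ P * P * log log M\<close> members, and recolouring a vertex by a member that agrees with its colour
  at the positions where this colour first differs from the known ones is again proper. So one
  such step costs two logarithms.

  Forgetting \<open>A_\<delta>\<close> maps \<open>W_r(m,\<sigma>,\<delta>)\<close> to \<open>W_r(m,\<sigma>,\<delta>-1)\<close>, and the images of the
  neighbours of a fixed vertex are described by one subset of \<open>A_{\<delta>-1}\<close> and one of \<open>A_\<delta>\<close>; hence
  \<open>P = 2 ^ (r ^ (\<sigma>+\<delta>-2) * (r+1))\<close> suffices, and the theorem follows by induction on \<open>\<delta>\<close>.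
\<close>

section \<open>Universal set families by greedy covering\<close>

text \<open>By double counting of pairs, some \<open>w\<close> satisfies at least a fraction
  \<open>1 / q\<close> of whatever is still unsatisfied. Picking such a \<open>w\<close> leaves at
  most the factor \<open>1 - 1 / q\<close> of the remainder.\<close>

lemma greedy_cover:
  fixes sat :: "'w \<Rightarrow> 'u \<Rightarrow> bool" and q :: nat
  assumes "finite U" "finite W" "W \<noteq> {}" "q > 0"
    and dense: "\<And>u. u \<in> U \<Longrightarrow> card W \<le> q * card {w \<in> W. sat w u}"
  shows "\<exists>ws. length ws = t \<and> set ws \<subseteq> W \<and>
    real (card {u \<in> U. \<forall>w\<in>set ws. \<not> sat w u}) \<le> real (card U) * (1 - 1 / real q) ^ t"
proof (induction t)
  case 0
  show ?case by (intro exI[of _ "[]"]) auto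
next
  case (Suc t)
  then obtain ws where ws: "length ws = t" "set ws \<subseteq> W"
    and le: "real (card {u \<in> U. \<forall>w\<in>set ws. \<not> sat w u}) \<le> real (card U) * (1 - 1 / real q) ^ t"
    by blast
  define R where "R = {u \<in> U. \<forall>w\<in>set ws. \<not> sat w u}"
  have fR: "finite R" and RU: "R \<subseteq> U" using assms(1) by (auto simp: R_def)
  \<comment> \<open>If every \<open>w\<close> fell short, summing over \<open>W\<close> and
    exchanging the sums would contradict the density hypothesis summed over
    \<open>R\<close>.\<close>
  have "\<exists>w\<in>W. card R \<le> q * card {u \<in> R. sat w u}"
  proof (rule ccontr)
    assume "\<not> ?thesis"
    then have *: "q * card {u \<in> R. sat w u} < card R" if "w \<in> W" for w
      using that by (auto simp: not_le)
    have "(\<Sum>w\<in>W. q * card {u \<in> R. sat w u}) < (\<Sum>w\<in>W. card R)"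
      by (rule sum_strict_mono) (use * assms in auto)
    also have "\<dots> = (\<Sum>u\<in>R. card W)" by simp
    also have "\<dots> \<le> (\<Sum>u\<in>R. q * card {w \<in> W. sat w u})"
      by (rule sum_mono) (use dense RU in auto)
    also have "\<dots> = (\<Sum>w\<in>W. q * card {u \<in> R. sat w u})"
      unfolding sum_distrib_left[symmetric]
      using sum_multicount_gen[OF assms(2) fR, of "\<lambda>w u. sat w u" "\<lambda>u. card {w \<in> W. sat w u}"]
      by simp
    finally show False by simp
  qed
  then obtain w where w: "w \<in> W" "card R \<le> q * card {u \<in> R. sat w u}" by blast
  have split: "card R = card {u \<in> R. sat w u} + card {u \<in> R. \<not> sat w u}"
    by (subst card_Un_disjoint[symmetric]) (use fR in \<open>auto intro!: arg_cong[where f = card]\<close>)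
  have "real (card R) \<le> real q * real (card {u \<in> R. sat w u})"
    using w(2) by (metis of_nat_le_iff of_nat_mult)
  then have "real (card R) / real q \<le> real (card {u \<in> R. sat w u})"
    using assms(4) by (simp add: field_simps)
  then have "real (card {u \<in> R. \<not> sat w u}) \<le> real (card R) * (1 - 1 / real q)"
    using split by (simp add: algebra_simps add_divide_distrib)
  also have "\<dots> \<le> (real (card U) * (1 - 1 / real q) ^ t) * (1 - 1 / real q)"
    by (rule mult_right_mono) (use le assms(4) in \<open>auto simp: R_def\<close>)
  finally have "real (card {u \<in> R. \<not> sat w u}) \<le> real (card U) * (1 - 1 / real q) ^ Suc t"
    by (simp add: mult_ac)
  moreover have "{u \<in> R. \<not> sat w u} = {u \<in> U. \<forall>w\<in>set (w # ws). \<not> sat w u}"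
    by (auto simp: R_def)
  ultimately show ?case
    using ws w(1) by (intro exI[of _ "w # ws"]) auto
qed

lemma exists_list_of_set_length:
  assumes "finite E" "E \<noteq> {}" "card E \<le> k"
  shows "\<exists>xs. set xs = E \<and> length xs = k"
proof -
  obtain ys where ys: "set ys = E" "distinct ys"
    using assms(1) finite_distinct_list by blast
  then have "length ys \<le> k" "ys \<noteq> []"
    using assms distinct_card[of ys] by auto
  then show ?thesis
    using ys by (intro exI[of _ "ys @ replicate (k - length ys) (hd ys)"]) auto
qed

text \<open>A demand is a list of \<open>k\<close> position-bit pairs; there are at most
  \<open>(2 * T) ^ k\<close> demands. Each consistent one is met by a fraction of at least
  \<open>1 / 2 ^ k\<close> of all subsets of \<open>{..<T}\<close>, so greedy covering applies with
  \<open>q = 2 ^ k\<close>.\<close>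

lemma universal_sets:
  fixes T k :: nat
  assumes T: "T \<ge> 1" and k: "k \<ge> 1"
  shows "\<exists>Ss :: nat set list. real (length Ss) \<le> 2 ^ k * real k * log 2 (2 * real T) + 1 \<and>
    (\<forall>D X. D \<subseteq> {..<T} \<and> card D \<le> k \<and> X \<subseteq> D \<longrightarrow> (\<exists>S\<in>set Ss. S \<inter> D = X))"
proof -
  define sat :: "nat set \<Rightarrow> (nat \<times> bool) list \<Rightarrow> bool"
    where "sat = (\<lambda>S xs. \<forall>(d, b)\<in>set xs. (d \<in> S) = b)"
  define L where "L = {xs. set xs \<subseteq> {..<T} \<times> (UNIV :: bool set) \<and> length xs = k}"
  \<comment> \<open>Lists asking for both bits at one position cannot be met by any set and are left
    out.\<close>
  define U where "U = {xs \<in> L. \<exists>S. sat S xs}"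
  have fL: "finite L" unfolding L_def by (rule finite_lists_length_eq) auto
  have "card L = (2 * T) ^ k"
    unfolding L_def by (subst card_lists_length_eq) (auto simp: card_cartesian_product mult.commute)
  then have cU: "card U \<le> (2 * T) ^ k"
    using card_mono[OF fL, of U] by (auto simp: U_def)
  have fU: "finite U" using fL by (auto simp: U_def)
  have dense: "card (Pow {..<T}) \<le> 2 ^ k * card {S \<in> Pow {..<T}. sat S xs}" if xs: "xs \<in> U" for xs
  proof -
    obtain S0 where S0: "sat S0 xs" using xs by (auto simp: U_def)
    define D where "D = fst ` set xs"
    have len: "length xs = k" and D: "D \<subseteq> {..<T}" using xs by (auto simp: U_def L_def D_def)
    have cD: "card D \<le> k"
      unfolding D_def using card_image_le[of "set xs" fst] card_length[of xs] len by simp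
    let ?F = "{S \<in> Pow {..<T}. sat S xs}"
    have fD: "finite D" using D finite_subset by blast
    \<comment> \<open>Overwriting the trace of \<open>S\<close> on \<open>D\<close> by that of
      \<open>S0\<close> gives a set meeting the demand. Together with the old trace
      \<open>S \<inter> D\<close> it determines \<open>S\<close>, and there are at most
      \<open>2 ^ k\<close> traces.\<close>
    have "Pow {..<T} \<subseteq> (\<lambda>(S, Z). (S - D) \<union> Z) ` (?F \<times> Pow D)"
    proof
      fix S assume S: "S \<in> Pow {..<T}"
      have "(S - D) \<union> (S0 \<inter> D) \<in> ?F"
      proof -
      have "sat ((S - D) \<union> (S0 \<inter> D)) xs"
        unfolding sat_def
      proof clarify
        fix d b assume db: "(d, b) \<in> set xs"
        then have "d \<in> D" by (force simp: D_def)
        moreover have "(d \<in> S0) = b" using S0 db by (auto simp: sat_def)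
        ultimately show "(d \<in> S - D \<union> S0 \<inter> D) = b" by blast
      qed
      then show ?thesis using S D by blast
    qed
      moreover have "S = ((S - D) \<union> (S0 \<inter> D) - D) \<union> (S \<inter> D)" by blast
      ultimately show "S \<in> (\<lambda>(S, Z). (S - D) \<union> Z) ` (?F \<times> Pow D)"
        by (intro image_eqI[of _ _ "((S - D) \<union> (S0 \<inter> D), S \<inter> D)"]) auto
    qed
    then have "card (Pow {..<T}) \<le> card (?F \<times> Pow D)"
      by (rule surj_card_le[rotated]) (use fD in auto)
    also have "\<dots> = card ?F * 2 ^ card D"
      using fD by (simp add: card_cartesian_product card_Pow)
    also have "\<dots> \<le> card ?F * 2 ^ k" using cD by simp
    finally show ?thesis by (simp add: mult.commute)
  qed
  \<comment> \<open>Adding 1 to the floor makes \<open>t\<close> strictly exceed the bound, so fewer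
    than one demand remains, that is, none.\<close>
  define t where "t = nat \<lfloor>2 ^ k * real k * ln (2 * real T)\<rfloor> + 1"
  have "\<exists>Ss. length Ss = t \<and> set Ss \<subseteq> Pow {..<T} \<and>
      real (card {u \<in> U. \<forall>S\<in>set Ss. \<not> sat S u}) \<le> real (card U) * (1 - 1 / real (2 ^ k)) ^ t"
    by (rule greedy_cover[OF fU _ _ _ dense]) auto
  then obtain Ss where Ss: "length Ss = t"
    and le: "real (card {u \<in> U. \<forall>S\<in>set Ss. \<not> sat S u})
              \<le> real (card U) * (1 - 1 / real (2 ^ k)) ^ t"
    by blast
  have lnT: "ln (2 * real T) \<ge> 0" using T by simp
  have tgt: "real t > 2 ^ k * real k * ln (2 * real T)"
    unfolding t_def using lnT by (simp add: of_nat_nat) linarith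
  have "(1 - 1 / real (2 ^ k)) ^ t \<le> exp (- (1 / 2 ^ k)) ^ t"
    by (rule power_mono) (use exp_ge_add_one_self[of "- (1 / 2 ^ k)"] in auto)
  also have "\<dots> = exp (- (real t / 2 ^ k))"
    by (simp add: exp_of_nat_mult[symmetric])
  also have "\<dots> < exp (- (real k * ln (2 * real T)))"
    using tgt by (simp add: field_simps)
  also have "\<dots> = 1 / (2 * real T) ^ k"
    using T by (simp add: exp_minus exp_of_nat_mult inverse_eq_divide)
  finally have lt: "(1 - 1 / real (2 ^ k)) ^ t < 1 / (2 * real T) ^ k" .
  have "real (card U) * (1 - 1 / real (2 ^ k)) ^ t \<le> (2 * real T) ^ k * (1 - 1 / real (2 ^ k)) ^ t"
    using of_nat_mono[OF cU, where ?'a = real] by (intro mult_right_mono) auto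
  also have "\<dots> < 1"
    using lt T by (simp add: field_simps)
  finally have "card {u \<in> U. \<forall>S\<in>set Ss. \<not> sat S u} = 0" using le by linarith
  then have cover: "\<exists>S\<in>set Ss. sat S u" if "u \<in> U" for u
    using that fU by auto
  have "\<exists>S\<in>set Ss. S \<inter> D = X" if D: "D \<subseteq> {..<T}" "card D \<le> k" "X \<subseteq> D" for D X
  proof (cases "D = {}")
    case True
    \<comment> \<open>As \<open>k \<ge> 1\<close>, the empty set of positions is not the position
      set of any demand. Here any member serves, and \<open>t \<ge> 1\<close> provides one.\<close>
    have "Ss \<noteq> []" using Ss by (auto simp: t_def)
    then show ?thesis using True D by (intro bexI[of _ "hd Ss"]) auto
  next
    case False
    have fD: "finite D" using D finite_subset by blast
    obtain ds where ds: "set ds = D" "length ds = k"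
      using exists_list_of_set_length[OF fD False D(2)] by blast
    let ?xs = "map (\<lambda>d. (d, d \<in> X)) ds"
    have "sat X ?xs" by (auto simp: sat_def)
    then have "?xs \<in> U" using ds D by (auto simp: U_def L_def)
    then obtain S where "S \<in> set Ss" "sat S ?xs" using cover by blast
    then show ?thesis using ds D by (intro bexI[of _ S]) (auto simp: sat_def)
  qed
  moreover have "real (length Ss) \<le> 2 ^ k * real k * log 2 (2 * real T) + 1"
  proof -
    have "real t \<le> 2 ^ k * real k * ln (2 * real T) + 1"
      unfolding t_def using lnT by (simp add: of_nat_nat)
    moreover have "ln (2 * real T) \<le> log 2 (2 * real T)"
      using lnT ln_2_less_1 ln_gt_zero[of 2]
      by (simp add: log_def divide_simps mult_left_le)
    then have "2 ^ k * real k * ln (2 * real T) \<le> 2 ^ k * real k * log 2 (2 * real T)"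
      by (rule mult_left_mono) simp
    ultimately show ?thesis unfolding Ss by linarith
  qed
  ultimately show ?thesis by blast
qed

section \<open>Recolouring by first differing bits\<close>

lemma exists_bit_diff:
  fixes a b :: nat
  assumes "a \<noteq> b" "a < 2 ^ T" "b < 2 ^ T"
  shows "\<exists>d<T. bit a d \<noteq> bit b d"
proof -
  have "take_bit T a \<noteq> take_bit T b" using assms by (simp add: take_bit_nat_eq_self)
  then show ?thesis by (auto simp: bit_eq_iff bit_take_bit_iff)
qed

text \<open>At an edge, the first position where the bits of \<open>f u\<close> and
  \<open>f v\<close> differ is recorded at both ends, since each end knows the other's colour. The
  members chosen at \<open>u\<close> and \<open>v\<close> copy the respective bits there, so they
  differ.\<close>

lemma local_colouring:
  fixes f :: "'a \<Rightarrow> nat"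
  assumes f: "\<And>v. v \<in> V \<Longrightarrow> f v < 2 ^ T"
    and Q: "\<And>v. v \<in> V \<Longrightarrow> finite (Q v) \<and> card (Q v) \<le> k"
    and edge: "\<And>u v. u \<in> V \<Longrightarrow> v \<in> V \<Longrightarrow> adj u v \<Longrightarrow> f u \<noteq> f v \<and> f u \<in> Q v \<and> f v \<in> Q u"
    and T: "T \<ge> 1" and k: "k \<ge> 1"
  shows "\<exists>c t. proper_colouring V adj t c \<and> real t \<le> 2 ^ k * real k * log 2 (2 * real T) + 1"
proof -
  obtain Ss :: "nat set list" where len: "real (length Ss) \<le> 2 ^ k * real k * log 2 (2 * real T) + 1"
    and univ: "\<forall>D X. D \<subseteq> {..<T} \<and> card D \<le> k \<and> X \<subseteq> D \<longrightarrow> (\<exists>S\<in>set Ss. S \<inter> D = X)"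
    using universal_sets[OF T k] by (elim exE conjE)
  define p where "p a b = (LEAST d. bit a d \<noteq> bit b d)" for a b :: nat
  have p_sym: "p a b = p b a" for a b unfolding p_def by (rule arg_cong[where f = Least]) auto
  have p: "p a b < T \<and> bit a (p a b) \<noteq> bit b (p a b)"
    if ab: "a \<noteq> b" "a < 2 ^ T" "b < 2 ^ T" for a b
  proof -
    obtain d where "d < T" "bit a d \<noteq> bit b d" using exists_bit_diff[OF ab] by blast
    then show ?thesis
      using LeastI[of "\<lambda>d. bit a d \<noteq> bit b d" d] Least_le[of "\<lambda>d. bit a d \<noteq> bit b d" d]
      unfolding p_def by linarith
  qed
  \<comment> \<open>The filter is needed because \<open>Q v\<close> may contain \<open>f v\<close>
    itself, where \<open>p\<close> is unspecified, or colours beyond \<open>2 ^ T\<close>, whose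
    first difference may lie outside \<open>{..<T}\<close>.\<close>
  define D where "D v = p (f v) ` {b \<in> Q v. p (f v) b < T}" for v
  have "\<exists>i<length Ss. Ss ! i \<inter> D v = {d \<in> D v. bit (f v) d}" if v: "v \<in> V" for v
  proof -
    have "card (D v) \<le> card {b \<in> Q v. p (f v) b < T}"
      unfolding D_def by (rule card_image_le) (use Q v in auto)
    also have "\<dots> \<le> card (Q v)" by (rule card_mono) (use Q v in auto)
    also have "\<dots> \<le> k" using Q v by blast
    finally have "card (D v) \<le> k" .
    moreover have "D v \<subseteq> {..<T}" by (auto simp: D_def)
    ultimately have "\<exists>S\<in>set Ss. S \<inter> D v = {d \<in> D v. bit (f v) d}"
      using univ by simp
    then obtain S where "S \<in> set Ss" "S \<inter> D v = {d \<in> D v. bit (f v) d}" by blast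
    then show ?thesis by (metis in_set_conv_nth)
  qed
  then obtain c where c: "\<And>v. v \<in> V \<Longrightarrow> c v < length Ss \<and> Ss ! c v \<inter> D v = {d \<in> D v. bit (f v) d}"
    by metis
  have "proper_colouring V adj (length Ss) c"
    unfolding proper_colouring_def
  proof (intro conjI ballI impI)
    fix v assume "v \<in> V" then show "c v < length Ss" using c by blast
  next
    fix u v assume uv: "u \<in> V" "v \<in> V" "adj u v"
    let ?d = "p (f u) (f v)"
    have d: "?d < T" "bit (f u) ?d \<noteq> bit (f v) ?d" using p[of "f u" "f v"] edge[OF uv] f uv by blast+
    then have "?d \<in> D u" using edge[OF uv] unfolding D_def by blast
    moreover have "?d \<in> D v"
      unfolding D_def p_sym[of "f u" "f v"]
      by (rule imageI) (use edge[OF uv] d(1) p_sym[of "f u" "f v"] in simp)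
    ultimately have "?d \<in> Ss ! c u \<longleftrightarrow> bit (f u) ?d" "?d \<in> Ss ! c v \<longleftrightarrow> bit (f v) ?d"
      using c[OF uv(1)] c[OF uv(2)] by blast+
    then show "c u \<noteq> c v" using d by auto
  qed
  then show ?thesis using len by blast
qed

section \<open>Numerical cost of one recolouring\<close>

lemma sixteen_power: "(16::real) ^ n = 2 powr (4 * real n)"
proof -
  have "(16::real) ^ n = 2 ^ (4 * n)" by (simp add: power_mult)
  then show ?thesis by (simp add: powr_realpow[symmetric])
qed

text \<open>The factor \<open>16 ^ P\<close> reproduces itself: a colour count of at most
  \<open>16 ^ P * x\<close> becomes one of at most \<open>16 ^ P * log 2 (log 2 x)\<close>. This
  keeps the constant from growing along the induction.\<close>

lemma universal_count_bound:
  fixes P :: nat and x :: real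
  assumes P: "P \<ge> 1" and M: "real M \<le> 16 ^ P * x"
    and x: "x > 0" "log 2 x > 0" "log 2 (log 2 x) \<ge> 1"
  shows "\<exists>T\<ge>1. M \<le> 2 ^ T \<and> 2 ^ P * real P * log 2 (2 * real T) + 1 \<le> 16 ^ P * log 2 (log 2 x)"
proof -
  define L where "L = log 2 x"
  define y where "y = log 2 L"
  have L: "L \<ge> 2"
    using x by (simp add: L_def le_log_iff)
  have y: "y \<ge> 1" using x by (simp add: y_def L_def)
  define T where "T = nat \<lceil>4 * real P + L\<rceil>"
  have T: "real T \<ge> 4 * real P + L" "real T \<le> 4 * real P + L + 1"
    unfolding T_def using L by linarith+
  have T1: "T \<ge> 1" using T(1) L P by linarith
  have "16 ^ P * x = 2 powr (4 * real P + L)"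
    using x by (simp add: powr_add L_def sixteen_power)
  also have "\<dots> \<le> 2 powr real T" using T by simp
  also have "\<dots> = real (2 ^ T)" by (simp add: powr_realpow)
  finally have MT: "M \<le> 2 ^ T" using order.trans[OF M] of_nat_le_iff by blast
  \<comment> \<open>Expanding the product bounds \<open>8 * P + 2 * L\<close> by
    \<open>4 * P * L + 4\<close>; the next claim is then linear in \<open>P\<close>,
    \<open>L\<close> and \<open>P * L\<close>.\<close>
  have "(4 * real P - 2) * (L - 2) \<ge> 0" using P L by simp
  then have "2 * real T \<le> 16 * real P * L"
    using T P L by (simp add: algebra_simps)
  then have "log 2 (2 * real T) \<le> log 2 (16 * real P * L)"
    using T1 by (intro log_mono) auto
  also have "\<dots> = 4 + log 2 (real P) + y"
    using P L log_pow_cancel[of 2 4] by (simp add: log_mult y_def)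
  also have "log 2 (real P) \<le> real P"
    using P by (simp add: log_le_iff powr_realpow less_imp_le)
  also have "4 + real P + y \<le> (5 + real P) * y"
    using mult_left_mono[OF y, of "4 + real P"] by (simp add: algebra_simps)
  finally have "2 ^ P * real P * log 2 (2 * real T) + 1 \<le> 2 ^ P * real P * ((5 + real P) * y) + 2 ^ P * y"
    using y mult_mono[of 1 "2 ^ P" 1 y] by (intro add_mono mult_left_mono) auto
  also have "\<dots> = 2 ^ P * (real P * (5 + real P) + 1) * y"
    by (simp add: algebra_simps)
  also have "\<dots> \<le> 2 ^ P * 8 ^ P * y"
  proof -
    \<comment> \<open>This fixes the base 16 as 2 * 8: the universal family costs
      \<open>2 ^ P\<close>, and \<open>8 ^ P\<close> absorbs the polynomial factor, already at
      \<open>P = 1\<close>, where 7 is at most 8.\<close>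
    have "P * (5 + P) + 1 \<le> 8 ^ P"
      using P by (induction P rule: nat_induct_at_least) (auto simp: algebra_simps)
    then have "real (P * (5 + P) + 1) \<le> real (8 ^ P)" by (simp only: of_nat_le_iff)
    then show ?thesis using y by (intro mult_right_mono mult_left_mono) auto
  qed
  also have "\<dots> = 16 ^ P * y" by (simp flip: power_mult_distrib)
  finally show ?thesis using T1 MT by (auto simp: y_def L_def)
qed

section \<open>Truncated vertices and their neighbourhoods\<close>

lemma W_chain_subset:
  assumes "(\<alpha>, A) \<in> W_vertices r m \<sigma> \<delta>" "i \<le> j" "j < \<delta>"
  shows "A ! i \<subseteq> A ! j"
  using assms(2,3)
proof (induction rule: dec_induct)
  case (step n)
  then show ?case using assms(1) by (auto simp: W_vertices_def)
qed simp

lemma W_chain_subset_range: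
  assumes "(\<alpha>, A) \<in> W_vertices r m \<sigma> \<delta>" "i < \<delta>"
  shows "A ! i \<subseteq> {1..m}"
proof -
  have "A ! i \<subseteq> A ! (\<delta> - 1)" using assms by (intro W_chain_subset) auto
  also have "\<dots> \<subseteq> {1..m}" using assms by (auto simp: W_vertices_def)
  finally show ?thesis .
qed

lemma W_vertices_take:
  assumes "(\<alpha>, A) \<in> W_vertices r m \<sigma> (Suc \<delta>)" "\<delta> \<ge> 1"
  shows "(\<alpha>, take \<delta> A) \<in> W_vertices r m \<sigma> \<delta>"
  using W_chain_subset_range[OF assms(1), of "\<delta> - 1"] assms by (auto simp: W_vertices_def)

lemma W_adj_take:
  assumes "W_adj (Suc \<delta>) (\<alpha>, A) (\<beta>, B)" "\<delta> \<ge> 1"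
  shows "W_adj \<delta> (\<alpha>, take \<delta> A) (\<beta>, take \<delta> B)"
  using assms by (auto simp: W_adj_def)

text \<open>
  In 0-based indices, a neighbour satisfies \<open>A ! (i - 1) \<subseteq> B ! i \<subseteq> A ! Suc i\<close>. So \<open>B ! i\<close> is determined by
  its traces on the layers \<open>A ! i - A ! (i - 1)\<close> (recorded in \<open>X\<close>) and \<open>A ! Suc i - A ! i\<close> (recorded
  in \<open>Y\<close>). Nothing of \<open>Y\<close> is recorded in \<open>A ! 0\<close>, which leaves room there for \<open>\<beta>\<close>.
\<close>
lemma card_W_neighbours_take:
  assumes v: "(\<alpha>, A) \<in> W_vertices r m \<sigma> (Suc \<delta>)" and d: "\<delta> \<ge> 1"
  defines "N \<equiv> {(\<beta>, take \<delta> B) | \<beta> B.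
    (\<beta>, B) \<in> W_vertices r m \<sigma> (Suc \<delta>) \<and> W_adj (Suc \<delta>) (\<beta>, B) (\<alpha>, A)}"
  shows "finite N \<and> card N \<le> 2 ^ (r ^ (\<sigma> + \<delta> - 1) * (r + 1))"
proof -
  define prev where "prev i = (if i = 0 then {} else A ! (i - 1))" for i
  define level where "level X Y i =
    (Y \<inter> (A ! Suc i - A ! i)) \<union> (X \<inter> (A ! i - prev i)) \<union> prev i" for X Y i
  \<comment> \<open>\<open>dec\<close> rebuilds a truncated neighbour from two sets; its first
    component is the only element of \<open>Y\<close> in \<open>A ! 0\<close>.\<close>
  define dec where "dec = (\<lambda>(X, Y). (THE \<beta>. \<beta> \<in> Y \<inter> A ! 0, map (level X Y) [0..<\<delta>]))"
  have chain: "A ! i \<subseteq> A ! j" if "i \<le> j" "j \<le> \<delta>" for i j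
    using W_chain_subset[OF v] that by auto
  have fin: "finite (A ! i)" if "i \<le> \<delta>" for i
    using W_chain_subset_range[OF v, of i] that finite_subset by (meson finite_atLeastAtMost le_imp_less_Suc)
  have cardA: "card (A ! i) = r ^ i * r ^ \<sigma>" if "i \<le> \<delta>" for i
    using v that by (auto simp: W_vertices_def)
  have sub: "N \<subseteq> dec ` (Pow (A ! (\<delta> - 1)) \<times> Pow (A ! \<delta>))"
  proof
    fix w assume "w \<in> N"
    then obtain \<beta> B where w: "w = (\<beta>, take \<delta> B)"
      and B: "(\<beta>, B) \<in> W_vertices r m \<sigma> (Suc \<delta>)" and adj: "W_adj (Suc \<delta>) (\<beta>, B) (\<alpha>, A)"
      by (auto simp: N_def)
    have lenB: "length B = Suc \<delta>" using B by (auto simp: W_vertices_def)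
    have \<beta>: "\<beta> \<in> A ! 0" using adj by (auto simp: W_adj_def)
    have BA: "B ! i \<subseteq> A ! Suc i" "A ! i \<subseteq> B ! Suc i" if "i < \<delta>" for i
      using adj that by (auto simp: W_adj_def)
    define X where "X = (\<Union>i<\<delta>. (A ! i - prev i) \<inter> B ! i)"
    define Y where "Y = insert \<beta> (\<Union>i<\<delta>. (A ! Suc i - A ! i) \<inter> B ! i)"
    \<comment> \<open>The layers are pairwise disjoint, so one union stores the traces of all
      \<open>B ! i\<close> without mixing them.\<close>
    have disj: "i = j" if "x \<in> A ! i - prev i" "x \<in> A ! j - prev j" "i \<le> \<delta>" "j \<le> \<delta>" for x i j
    proof -
      have False if ij: "i < j" "j \<le> \<delta>" "x \<in> A ! i" "x \<notin> prev j" for i j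
      proof -
        have "A ! i \<subseteq> A ! (j - 1)" using ij by (intro chain) auto
        then show False using ij by (auto simp: prev_def)
      qed
      then show ?thesis using that by (meson DiffE linorder_neqE_nat)
    qed
    have prevS: "prev (Suc i) = A ! i" for i by (simp add: prev_def)
    have "Y \<inter> A ! 0 = {\<beta>}"
    proof -
      have "A ! 0 \<subseteq> A ! i" if "i < \<delta>" for i using that by (intro chain) auto
      then show ?thesis unfolding Y_def using \<beta> by blast
    qed
    then have the: "(THE \<beta>. \<beta> \<in> Y \<inter> A ! 0) = \<beta>" by simp
    have "level X Y i = B ! i" if i: "i < \<delta>" for i
    proof -
      have X: "X \<inter> (A ! i - prev i) = (A ! i - prev i) \<inter> B ! i"
        using disj i unfolding X_def by (auto, metis Diff_iff less_imp_le)
      have Y: "Y \<inter> (A ! Suc i - A ! i) = (A ! Suc i - A ! i) \<inter> B ! i"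
      proof -
        have "\<beta> \<in> A ! i" using \<beta> chain[of 0 i] i by auto
        moreover have "j = i" if "x \<in> A ! Suc j - A ! j" "x \<in> A ! Suc i - A ! i" "j < \<delta>" for x j
          using disj[of x "Suc j" "Suc i"] that i by (simp add: prevS)
        ultimately show ?thesis using i unfolding Y_def by blast
      qed
      have p: "prev i \<subseteq> B ! i" using BA(2)[of "i - 1"] i by (cases i) (auto simp: prev_def)
      have "prev i \<subseteq> A ! i" using chain[of "i - 1" i] i by (auto simp: prev_def)
      then show ?thesis unfolding level_def X Y using BA(1)[OF i] p by blast
    qed
    then have "map (level X Y) [0..<\<delta>] = take \<delta> B"
      using lenB by (intro nth_equalityI) auto
    then have "w = dec (X, Y)" using the w by (simp add: dec_def)
    moreover have "X \<subseteq> A ! (\<delta> - 1)"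
    proof -
      have "A ! i \<subseteq> A ! (\<delta> - 1)" if "i < \<delta>" for i using that by (intro chain) auto
      then show ?thesis by (auto simp: X_def)
    qed
    moreover have "Y \<subseteq> A ! \<delta>"
    proof -
      have "A ! Suc i \<subseteq> A ! \<delta>" if "i < \<delta>" for i using that by (intro chain) auto
      moreover have "\<beta> \<in> A ! \<delta>" using \<beta> chain[of 0 \<delta>] by auto
      ultimately show ?thesis by (auto simp: Y_def)
    qed
    ultimately show "w \<in> dec ` (Pow (A ! (\<delta> - 1)) \<times> Pow (A ! \<delta>))" by blast
  qed
  have f: "finite (Pow (A ! (\<delta> - 1)) \<times> Pow (A ! \<delta>))" using fin by auto
  have "card N \<le> card (Pow (A ! (\<delta> - 1)) \<times> Pow (A ! \<delta>))"
    by (rule surj_card_le[OF f sub])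
  also have "\<dots> = 2 ^ (card (A ! (\<delta> - 1)) + card (A ! \<delta>))"
    using fin by (simp add: card_cartesian_product card_Pow power_add)
  also have "card (A ! (\<delta> - 1)) + card (A ! \<delta>) = r ^ (\<sigma> + \<delta> - 1) * (r + 1)"
    using d by (cases \<delta>) (simp_all add: cardA power_add algebra_simps)
  finally show ?thesis using finite_subset[OF sub] f by auto
qed

section \<open>Induction on \<open>\<delta>\<close> and the final bound\<close>

lemma iter_log_ge_1_mono:
  assumes "iter_log (Suc j) x \<ge> 1"
  shows "iter_log j x \<ge> 1"
proof -
  have pos: "iter_log j x > 0" using iter_log_ge_1_imp_pos[OF assms] by simp
  then have "log 2 (iter_log j x) \<ge> 1" using assms by simp
  then show ?thesis using pos by (simp add: le_log_iff)
qed

lemma iter_log_Suc_Suc: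
  assumes "iter_log (Suc (Suc j)) x \<ge> 1"
  shows "iter_log j x > 0" "log 2 (iter_log j x) > 0"
    "iter_log (Suc (Suc j)) x = log 2 (log 2 (iter_log j x))"
proof -
  have 1: "iter_log j x > 0" "iter_log (Suc j) x > 0"
    by (rule iter_log_ge_1_imp_pos[OF assms]; simp)+
  then show "iter_log j x > 0" "log 2 (iter_log j x) > 0"
    "iter_log (Suc (Suc j)) x = log 2 (log 2 (iter_log j x))" by simp_all
qed

text \<open>A single \<open>P\<close> serves all levels: the required neighbourhood bounds grow with
  \<open>\<delta>\<close>, so a \<open>P\<close> large enough at the top is large enough below. Each
  level contributes one application of \<open>local_colouring\<close>.\<close>

lemma W_colouring:
  fixes P :: nat
  assumes r: "r \<ge> 2" and "\<delta> \<ge> 1" and P1: "P \<ge> 1"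
    and "r ^ \<sigma> \<le> P" and "\<delta> \<ge> 2 \<Longrightarrow> 2 ^ (r ^ (\<sigma> + \<delta> - 2) * (r + 1)) \<le> P"
    and "iter_log (2 * \<delta>) (real m) \<ge> 1"
  shows "\<exists>c k. proper_colouring (W_vertices r m \<sigma> \<delta>) (W_adj \<delta>) k c \<and>
    real k \<le> 16 ^ P * iter_log (2 * \<delta>) (real m)"
  using assms(2,4-)
proof (induction \<delta> rule: nat_induct_at_least)
  case base
  let ?V = "W_vertices r m \<sigma> 1"
  have il: "iter_log (Suc (Suc 0)) (real m) \<ge> 1" using base by (simp add: numeral_2_eq_2)
  note L = iter_log_Suc_Suc[OF il]
  have "real m \<le> 16 ^ P * real m" by (simp add: mult_le_cancel_right1)
  then obtain T where T: "T \<ge> 1" "m \<le> 2 ^ T"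
    and t: "2 ^ P * real P * log 2 (2 * real T) + 1 \<le> 16 ^ P * log 2 (log 2 (real m))"
    using universal_count_bound[OF P1, of m "real m"] L il by auto
  have mem: "\<alpha> \<in> {1..m}" if "(\<alpha>, A) \<in> ?V" for \<alpha> A
    using that by (auto simp: W_vertices_def)
  have "\<exists>c t. proper_colouring ?V (W_adj 1) t c \<and> real t \<le> 2 ^ P * real P * log 2 (2 * real T) + 1"
  \<comment> \<open>The initial colour is \<alpha> itself, and the neighbours' colours are known to
    lie in \<open>A ! 0\<close>. The shift by 1 moves \<open>{1..m}\<close> below \<open>m\<close>,
    hence below \<open>2 ^ T\<close>.\<close>
  proof (rule local_colouring[where f = "\<lambda>v. fst v - 1" and Q = "\<lambda>v. (\<lambda>x. x - 1) ` (snd v ! 0)"])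
    fix v assume v: "v \<in> ?V"
    then show "fst v - 1 < 2 ^ T" using mem[of "fst v" "snd v"] T by auto
    have "finite (snd v ! 0)" "card (snd v ! 0) \<le> P"
      using v base finite_subset[OF _ finite_atLeastAtMost] by (auto simp: W_vertices_def)
    then show "finite ((\<lambda>x. x - 1) ` (snd v ! 0)) \<and> card ((\<lambda>x. x - 1) ` (snd v ! 0)) \<le> P"
      using card_image_le le_trans by blast
  next
    fix u v assume uv: "u \<in> ?V" "v \<in> ?V" "W_adj 1 u v"
    then show "fst u - 1 \<noteq> fst v - 1 \<and> fst u - 1 \<in> (\<lambda>x. x - 1) ` (snd v ! 0)
        \<and> fst v - 1 \<in> (\<lambda>x. x - 1) ` (snd u ! 0)"
      using mem[of "fst u" "snd u"] mem[of "fst v" "snd v"] by (auto simp: W_adj_def)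
  qed (use T P1 in auto)
  then show ?case using t L(3) by (force simp: numeral_2_eq_2)
next
  case (Suc \<delta>)
  let ?V = "W_vertices r m \<sigma> (Suc \<delta>)"
  have il: "iter_log (Suc (Suc (2 * \<delta>))) (real m) \<ge> 1" using Suc.prems by simp
  note L = iter_log_Suc_Suc[OF il]
  have ge1: "iter_log (2 * \<delta>) (real m) \<ge> 1"
    using iter_log_ge_1_mono[OF iter_log_ge_1_mono[OF il]] .
  have pow: "2 ^ (r ^ (\<sigma> + \<delta> - 1) * (r + 1)) \<le> P"
    using Suc.prems(2) Suc.hyps by simp
  have "2 ^ (r ^ (\<sigma> + \<delta> - 2) * (r + 1)) \<le> P" if "\<delta> \<ge> 2"
  proof -
    have "(2::nat) ^ (r ^ (\<sigma> + \<delta> - 2) * (r + 1)) \<le> 2 ^ (r ^ (\<sigma> + \<delta> - 1) * (r + 1))"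
      using r by (intro power_increasing mult_right_mono) auto
    then show ?thesis using pow by (rule order.trans)
  qed
  then obtain c k where c: "proper_colouring (W_vertices r m \<sigma> \<delta>) (W_adj \<delta>) k c"
    and k: "real k \<le> 16 ^ P * iter_log (2 * \<delta>) (real m)"
    using Suc.IH Suc.prems(1) ge1 by blast
  obtain T where T: "T \<ge> 1" "k \<le> 2 ^ T"
    and t: "2 ^ P * real P * log 2 (2 * real T) + 1 \<le> 16 ^ P * log 2 (log 2 (iter_log (2 * \<delta>) (real m)))"
    using universal_count_bound[OF P1 k] L il by auto
  define \<pi> :: "W_vertex \<Rightarrow> W_vertex" where "\<pi> = (\<lambda>(\<alpha>, A). (\<alpha>, take \<delta> A))"
  have \<pi>: "\<pi> v \<in> W_vertices r m \<sigma> \<delta>" if "v \<in> ?V" for v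
    using W_vertices_take that Suc.hyps by (cases v) (auto simp: \<pi>_def)
  have "\<exists>c t. proper_colouring ?V (W_adj (Suc \<delta>)) t c \<and> real t \<le> 2 ^ P * real P * log 2 (2 * real T) + 1"
  \<comment> \<open>A vertex inherits the colour of its truncation. Many neighbours may share a
    truncation, so the known colours are counted through the images under
    \<open>\<pi>\<close>.\<close>
  proof (rule local_colouring[where f = "\<lambda>v. c (\<pi> v)"
        and Q = "\<lambda>v. c ` \<pi> ` {u \<in> ?V. W_adj (Suc \<delta>) u v}"])
    fix v assume v: "v \<in> ?V"
    show "c (\<pi> v) < 2 ^ T"
      using c \<pi>[OF v] T by (auto simp: proper_colouring_def intro: less_le_trans)
    obtain \<alpha> A where v': "v = (\<alpha>, A)" by (cases v)
    have "\<pi> ` {u \<in> ?V. W_adj (Suc \<delta>) u v} = {(\<beta>, take \<delta> B) | \<beta> B.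
        (\<beta>, B) \<in> ?V \<and> W_adj (Suc \<delta>) (\<beta>, B) (\<alpha>, A)}"
      unfolding v' \<pi>_def by (auto simp: image_iff)
    then have "finite (\<pi> ` {u \<in> ?V. W_adj (Suc \<delta>) u v}) \<and>
        card (\<pi> ` {u \<in> ?V. W_adj (Suc \<delta>) u v}) \<le> P"
      using card_W_neighbours_take[OF v[unfolded v'] Suc.hyps] pow by auto
    then show "finite (c ` \<pi> ` {u \<in> ?V. W_adj (Suc \<delta>) u v}) \<and>
        card (c ` \<pi> ` {u \<in> ?V. W_adj (Suc \<delta>) u v}) \<le> P"
      using card_image_le le_trans by blast
  next
    fix u v assume uv: "u \<in> ?V" "v \<in> ?V" "W_adj (Suc \<delta>) u v"
    then have "W_adj \<delta> (\<pi> u) (\<pi> v)"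
      using W_adj_take Suc.hyps by (cases u; cases v) (auto simp: \<pi>_def)
    then show "c (\<pi> u) \<noteq> c (\<pi> v) \<and> c (\<pi> u) \<in> c ` \<pi> ` {w \<in> ?V. W_adj (Suc \<delta>) w v}
        \<and> c (\<pi> v) \<in> c ` \<pi> ` {w \<in> ?V. W_adj (Suc \<delta>) w u}"
      using c \<pi> uv W_adj_sym by (auto simp: proper_colouring_def)
  qed (use T P1 in auto)
  then show ?case using t L(3) by force
qed

theorem theorem3p3:
  fixes r \<sigma> \<delta> m :: nat
  assumes "r \<ge> 2" and "\<delta> \<ge> 1"
    and "iter_log (2 * \<delta>) (real m) \<ge> 1"
  shows "real (chromatic_number (W_vertices r m \<sigma> \<delta>) (W_adj \<delta>)) \<le>
    2 powr (2 powr (2 + real r powr (real \<sigma> + real \<delta> - 2) * (real r + 1)))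
      * iter_log (2 * \<delta>) (real m)"
proof -
  \<comment> \<open>The exponent is real because it is -1 for \<open>\<sigma> = 0\<close> and
    \<open>\<delta> = 1\<close>, where truncated subtraction would give 0.\<close>
  define e where "e = real r powr (real \<sigma> + real \<delta> - 2) * (real r + 1)"
  have "real r ^ \<sigma> = real r powr (real \<sigma> - 1) * real r"
    using assms(1) by (simp add: powr_diff powr_realpow)
  also have "\<dots> \<le> real r powr (real \<sigma> + real \<delta> - 2) * (real r + 1)"
    using assms by (intro mult_mono powr_mono) auto
  finally have re: "real r ^ \<sigma> \<le> e" by (simp add: e_def)
  \<comment> \<open>For \<open>\<delta> \<ge> 2\<close> the neighbourhood bound equals
    \<open>2 powr e\<close> and exceeds \<open>r ^ \<sigma>\<close>. For \<open>\<delta> = 1\<close>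
    only the initial sets matter, and \<open>P = r ^ \<sigma>\<close> suffices.\<close>
  have "\<exists>P::nat. P \<ge> 1 \<and> r ^ \<sigma> \<le> P \<and>
      (\<delta> \<ge> 2 \<longrightarrow> 2 ^ (r ^ (\<sigma> + \<delta> - 2) * (r + 1)) \<le> P) \<and> real P \<le> 2 powr e"
  proof (cases "\<delta> \<ge> 2")
    case True
    have "real \<sigma> + real \<delta> - 2 = real (\<sigma> + \<delta> - 2)" using True by simp
    then have e: "e = real (r ^ (\<sigma> + \<delta> - 2) * (r + 1))"
      unfolding e_def using assms(1) by (simp only: powr_realpow) (simp add: powr_realpow algebra_simps)
    have "r ^ \<sigma> \<le> r ^ (\<sigma> + \<delta> - 2) * (r + 1)"
      using re e by (metis of_nat_le_iff of_nat_power)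
    also have "\<dots> \<le> 2 ^ (r ^ (\<sigma> + \<delta> - 2) * (r + 1))" by (simp add: less_imp_le)
    finally show ?thesis
      by (intro exI[of _ "2 ^ (r ^ (\<sigma> + \<delta> - 2) * (r + 1))"]) (simp only: e powr_realpow, simp)
  next
    case False
    have "real (r ^ \<sigma>) \<le> 2 ^ (r ^ \<sigma>)" by (rule less_imp_le[OF of_nat_less_two_power])
    also have "\<dots> = 2 powr (real (r ^ \<sigma>))" by (simp only: powr_realpow)
    also have "\<dots> \<le> 2 powr e" using re by simp
    finally show ?thesis using False assms(1) by (intro exI[of _ "r ^ \<sigma>"]) auto
  qed
  then obtain P :: nat where P: "P \<ge> 1" "r ^ \<sigma> \<le> P"
    "\<delta> \<ge> 2 \<Longrightarrow> 2 ^ (r ^ (\<sigma> + \<delta> - 2) * (r + 1)) \<le> P" and Pe: "real P \<le> 2 powr e"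
    by blast
  obtain c k where c: "proper_colouring (W_vertices r m \<sigma> \<delta>) (W_adj \<delta>) k c"
    and k: "real k \<le> 16 ^ P * iter_log (2 * \<delta>) (real m)"
    using W_colouring[OF assms(1,2) P assms(3)] by blast
  have "chromatic_number (W_vertices r m \<sigma> \<delta>) (W_adj \<delta>) \<le> k"
    unfolding chromatic_number_def using c by (blast intro: Least_le)
  then have "real (chromatic_number (W_vertices r m \<sigma> \<delta>) (W_adj \<delta>))
      \<le> 16 ^ P * iter_log (2 * \<delta>) (real m)" using k by linarith
  also have "(16::real) ^ P = 2 powr (4 * real P)"
    by (rule sixteen_power)
  \<comment> \<open>The summand 2 in the exponent is the factor 4 from \<open>16 = 2 ^ 4\<close>, as
    \<open>4 * 2 powr e = 2 powr (2 + e)\<close>.\<close>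
  also have "2 powr (4 * real P) * iter_log (2 * \<delta>) (real m)
      \<le> 2 powr (2 powr (2 + e)) * iter_log (2 * \<delta>) (real m)"
    using Pe assms(3) by (intro mult_right_mono) (auto simp: powr_add)
  finally show ?thesis by (simp add: e_def)
qed

end
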